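(* For every integer $k\ge1$, $\mathcal{A}_{\mathbb{Q}}(Q_k)\cong\mathbb{Q}^{k+1}$ as $\mathbb{Q}$-algebras.
   Context: $Q_k=\mathrm{Cay}((\mathbb{Z}/2)^k,\{e_1,\dots,e_k\})$ is the $k$-dimensional Hamming cube: the graph with vertex set $(\mathbb{Z}/2)^k$ in which $g$ and $h$ are adjacent if and only if $h-g\in\{e_1,\dots,e_k\}$, where $e_1,\dots,e_k$ are the standard basis vectors. $\mathcal{A}_{\mathbb{Q}}(Q_k)=\mathbb{Q}[A]\subseteq M_{2^k}(\mathbb{Q})$ is the algebra of all rational polynomials in the adjacency matrix $A$ of $Q_k$. *)

theory Defs
  imports
    "HOL-Algebra.Product_Groups"
    "HOL-Algebra.Elementary_Groups"
    "HOL-Algebra.QuotRing"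
    "HOL-Computational_Algebra.Polynomial"
    "Jordan_Normal_Form.VS_Connect"
    "Graph_Theory.Pair_Digraph"
begin

(* The connection set S is not required to be symmetric, so this is in general a digraph. *)
definition cayley_graph :: "('a, 'b) monoid_scheme \<Rightarrow> 'a set \<Rightarrow> 'a pair_pre_digraph" where
  "cayley_graph G S =
     \<lparr>pverts = carrier G,
      parcs = {(g, h). g \<in> carrier G \<and> h \<in> carrier G \<and> h \<otimes>\<^bsub>G\<^esub> inv\<^bsub>G\<^esub> g \<in> S}\<rparr>"

definition Z2_power :: "nat \<Rightarrow> (nat \<Rightarrow> int) monoid" where
  "Z2_power k = product_group {1..k} (\<lambda>_. integer_mod_group 2)"

definition std_basis :: "nat \<Rightarrow> nat \<Rightarrow> (nat \<Rightarrow> int)" where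
  "std_basis k i = (\<lambda>j\<in>{1..k}. if j = i then 1 else 0)"

definition hamming_cube :: "nat \<Rightarrow> (nat \<Rightarrow> int) pair_pre_digraph" where
  "hamming_cube k = cayley_graph (Z2_power k) (std_basis k ` {1..k})"

lemma card_hamming_cube: "card (pverts (hamming_cube k)) = 2 ^ k"
  by (simp add: hamming_cube_def cayley_graph_def Z2_power_def integer_mod_group_def card_PiE)

(* Rows and columns are numbered through an enumeration v of the vertices:
   index i < card (pverts G) stands for the vertex v i. *)
definition adjacency_matrix :: "'v pair_pre_digraph \<Rightarrow> (nat \<Rightarrow> 'v) \<Rightarrow> rat mat" where
  "adjacency_matrix G v =
     mat (card (pverts G)) (card (pverts G)) (\<lambda>(i, j). if (v i, v j) \<in> parcs G then 1 else 0)"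

definition vertex_enumeration :: "'v pair_pre_digraph \<Rightarrow> (nat \<Rightarrow> 'v) \<Rightarrow> bool" where
  "vertex_enumeration G v \<longleftrightarrow> bij_betw v {..<card (pverts G)} (pverts G)"

(* The value p(A) of a polynomial at an n x n matrix. *)
definition poly_mat :: "nat \<Rightarrow> 'a::comm_ring_1 poly \<Rightarrow> 'a mat \<Rightarrow> 'a mat" where
  "poly_mat n p A =
     (\<Oplus>\<^bsub>module_mat TYPE('a) n n\<^esub>i\<in>{..degree p}. coeff p i \<cdot>\<^sub>m (A ^\<^sub>m i))"

definition adjacency_algebra :: "'v pair_pre_digraph \<Rightarrow> (nat \<Rightarrow> 'v) \<Rightarrow> (rat, rat mat) module" where
  "adjacency_algebra G v =
     (let n = card (pverts G) in
      (module_mat TYPE(rat) n n)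
        \<lparr>carrier := {poly_mat n p (adjacency_matrix G v) | p :: rat poly. True}\<rparr>)"

(* module_vec leaves mult and one unspecified; here they are componentwise. *)
definition rat_power_algebra :: "nat \<Rightarrow> (rat, rat vec) module" where
  "rat_power_algebra n =
     (module_vec TYPE(rat) n)
       \<lparr>mult := (\<lambda>x y. vec n (\<lambda>i. x $ i * y $ i)), one := vec n (\<lambda>_. 1)\<rparr>"

(* ring_iso already demands bijectivity and preservation of the unit. *)
definition algebra_isomorphic ::
    "('a, 'r) ring_scheme \<Rightarrow> ('a, 'b, 'm) module_scheme \<Rightarrow> ('a, 'c, 'n) module_scheme \<Rightarrow> bool" where
  "algebra_isomorphic R M N \<longleftrightarrow>
     algebra R M \<and> algebra R N \<and>
     (\<exists>f \<in> ring_iso M N. \<forall>a \<in> carrier R. \<forall>x \<in> carrier M. f (a \<odot>\<^bsub>M\<^esub> x) = a \<odot>\<^bsub>N\<^esub> f x)"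

end

theory Submission
  imports Defs
begin

text \<open>The characters \<open>\<chi>\<^sub>T(g) = (-1)\<^bsup>\<Sum>i\<in>T. g i\<^esup>\<close>, for \<open>T \<subseteq> {1..k}\<close>, are eigenvectors of the adjacency matrix
  with eigenvalues \<open>k - 2|T|\<close>, and their orthogonality resolves the identity matrix. Hence a polynomial
  in the matrix is determined by its values at the \<open>k + 1\<close> distinct eigenvalues, and these values can be
  prescribed arbitrarily by interpolation.\<close>

section \<open>Interpolation over a field and entries of matrix polynomials\<close>

lemma poly_interpolation_exists:
  fixes f :: "'a::field \<Rightarrow> 'a"
  assumes "finite S"
  shows "\<exists>p. \<forall>x\<in>S. poly p x = f x"
  using assms
proof (induction S)
  case (insert a S)
  then obtain p where p: "\<forall>x\<in>S. poly p x = f x" by blast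
  define w where "w = (\<Prod>x\<in>S. [:-x, 1:])"
  have w: "poly w y = (\<Prod>x\<in>S. y - x)" for y
    by (simp add: w_def poly_prod)
  have wa: "poly w a \<noteq> 0"
    using insert by (auto simp: w)
  have wS: "poly w y = 0" if "y \<in> S" for y
    using insert that by (auto simp: w)
  \<comment> \<open>Newton's correction: the multiple of \<open>w\<close> vanishes at the old nodes
    and is scaled to move the value at the new node from \<open>poly p a\<close> to
    \<open>f a\<close>.\<close>
  define q where "q = p + [:(f a - poly p a) / poly w a:] * w"
  have "\<forall>x\<in>insert a S. poly q x = f x"
    using p wa wS by (auto simp: q_def)
  then show ?case by blast
qed simp

text \<open>Membership and entries go through one induction, because reading an entry of
  \<open>F s\<close> plus the partial sum requires the dimensions of that partial sum.\<close>

lemma index_finsum_module_mat: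
  fixes F :: "'b \<Rightarrow> 'a::comm_ring_1 mat"
  assumes "finite S" "\<And>s. s \<in> S \<Longrightarrow> F s \<in> carrier_mat n m"
  shows "finsum (module_mat TYPE('a) n m) F S \<in> carrier_mat n m \<and>
    (\<forall>i<n. \<forall>j<m. finsum (module_mat TYPE('a) n m) F S $$ (i, j) = (\<Sum>s\<in>S. F s $$ (i, j)))"
proof -
  interpret abelian_group "module_mat TYPE('a) n m" by (rule abelian_group_mat)
  show ?thesis
    using assms
  proof (induction S)
    case empty
    then show ?case by (simp add: module_mat_simps)
  next
    case (insert s S)
    have "F \<in> S \<rightarrow> carrier (module_mat TYPE('a) n m)" "F s \<in> carrier (module_mat TYPE('a) n m)"
      using insert.prems by (auto simp: module_mat_simps)
    then have "finsum (module_mat TYPE('a) n m) F (insert s S) =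
        F s + finsum (module_mat TYPE('a) n m) F S"
      using insert.hyps by (simp add: finsum_insert module_mat_simps)
    then show ?case
      using insert by auto
  qed
qed

lemma index_mult_mat_sum:
  assumes "A \<in> carrier_mat n m" "B \<in> carrier_mat m l" "i < n" "j < l"
  shows "(A * B) $$ (i, j) = (\<Sum>s<m. A $$ (i, s) * B $$ (s, j))"
  using assms by (auto simp: scalar_prod_def atLeast0LessThan)

lemma poly_mat_carrier:
  fixes A :: "'a::comm_ring_1 mat"
  assumes "A \<in> carrier_mat n n"
  shows "poly_mat n p A \<in> carrier_mat n n"
  unfolding poly_mat_def using assms by (intro index_finsum_module_mat[THEN conjunct1]) auto

lemma index_poly_mat:
  fixes A :: "'a::comm_ring_1 mat"
  assumes "A \<in> carrier_mat n n" "i < n" "j < n"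
  shows "poly_mat n p A $$ (i, j) = (\<Sum>d\<le>degree p. coeff p d * (A ^\<^sub>m d) $$ (i, j))"
proof -
  have "A ^\<^sub>m d \<in> carrier_mat n n" for d using assms by simp
  then have "dim_row (A ^\<^sub>m d) = n" "dim_col (A ^\<^sub>m d) = n" for d by blast+
  then show ?thesis
    unfolding poly_mat_def using assms
    by (subst index_finsum_module_mat[THEN conjunct2, rule_format])
      (auto intro!: sum.cong simp del: pow_mat_dim_square)
qed

section \<open>The componentwise algebra of rational vectors\<close>

lemma algebra_rat_power: "algebra (class_ring :: rat ring) (rat_power_algebra n)"
proof (rule algebraI)
  show "cring (class_ring :: rat ring)" by (rule class_cring.cring_axioms)
  show "cring (rat_power_algebra n)"
  proof (rule cringI)
    show "abelian_group (rat_power_algebra n)"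
    proof (rule abelian_groupI)
      fix x assume "x \<in> carrier (rat_power_algebra n)"
      then show "\<exists>y\<in>carrier (rat_power_algebra n).
          y \<oplus>\<^bsub>rat_power_algebra n\<^esub> x = \<zero>\<^bsub>rat_power_algebra n\<^esub>"
        by (intro bexI[of _ "- x"]) (auto simp: rat_power_algebra_def module_vec_simps)
    qed (auto simp: rat_power_algebra_def module_vec_simps intro!: eq_vecI)
    show "comm_monoid (rat_power_algebra n)"
      by (rule comm_monoidI) (auto simp: rat_power_algebra_def module_vec_simps intro!: eq_vecI)
  qed (auto simp: rat_power_algebra_def module_vec_simps algebra_simps intro!: eq_vecI)
qed (auto simp: rat_power_algebra_def module_vec_simps algebra_simps intro!: eq_vecI)

section \<open>Polynomials in a matrix with a spectral resolution\<close>

text \<open>The assumption \<open>resolution\<close> writes the identity matrix as the sum of the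
  rank-one matrices with entries \<open>\<phi> t i * \<psi> t j\<close>, where each
  \<open>\<phi> t\<close> is an eigenvector. The map \<open>ev\<close> may repeat values, so
  eigenvalues are listed with multiplicity.\<close>

locale spectral_resolution =
  fixes n :: nat and A :: "'a::field mat" and I :: "'t set" and ev :: "'t \<Rightarrow> 'a"
    and \<phi> \<psi> :: "'t \<Rightarrow> nat \<Rightarrow> 'a"
  assumes A_carrier: "A \<in> carrier_mat n n"
    and finite_index: "finite I"
    and eigen: "\<And>t i. t \<in> I \<Longrightarrow> i < n \<Longrightarrow> (\<Sum>l<n. A $$ (i, l) * \<phi> t l) = ev t * \<phi> t i"
    and nonzero: "\<And>t. t \<in> I \<Longrightarrow> \<exists>i<n. \<phi> t i \<noteq> 0"
    and resolution: "\<And>i j. i < n \<Longrightarrow> j < n \<Longrightarrow>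
      (\<Sum>t\<in>I. \<phi> t i * \<psi> t j) = (if i = j then 1 else 0)"
begin

lemma pow_eigen:
  assumes "t \<in> I" "i < n"
  shows "(\<Sum>l<n. (A ^\<^sub>m d) $$ (i, l) * \<phi> t l) = ev t ^ d * \<phi> t i"
proof (induction d)
  case 0
  have "(\<Sum>l<n. (A ^\<^sub>m 0) $$ (i, l) * \<phi> t l) = (\<Sum>l<n. if l = i then \<phi> t l else 0)"
    using A_carrier assms by (intro sum.cong) auto
  then show ?case using assms by simp
next
  case (Suc d)
  have "(\<Sum>l<n. (A ^\<^sub>m Suc d) $$ (i, l) * \<phi> t l) =
      (\<Sum>l<n. \<Sum>s<n. (A ^\<^sub>m d) $$ (i, s) * (A $$ (s, l) * \<phi> t l))"
    using A_carrier assms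
    by (intro sum.cong refl)
      (simp add: index_mult_mat_sum[of _ n n _ n] sum_distrib_right mult.assoc del: index_mult_mat)
  \<comment> \<open>As the power unfolds to \<open>A ^\<^sub>m d * A\<close>, exchanging the sums
    lets the single factor \<open>A\<close> meet the eigenvector first.\<close>
  also have "\<dots> = (\<Sum>s<n. (A ^\<^sub>m d) $$ (i, s) * (\<Sum>l<n. A $$ (s, l) * \<phi> t l))"
    by (subst sum.swap) (simp add: sum_distrib_left)
  also have "\<dots> = ev t * (\<Sum>s<n. (A ^\<^sub>m d) $$ (i, s) * \<phi> t s)"
    using assms by (simp add: eigen sum_distrib_left mult.left_commute)
  finally show ?case using Suc by simp
qed

lemma poly_eigen:
  assumes "t \<in> I" "i < n"
  shows "(\<Sum>l<n. poly_mat n p A $$ (i, l) * \<phi> t l) = poly p (ev t) * \<phi> t i"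
proof -
  have "(\<Sum>l<n. poly_mat n p A $$ (i, l) * \<phi> t l) =
      (\<Sum>l<n. \<Sum>d\<le>degree p. coeff p d * ((A ^\<^sub>m d) $$ (i, l) * \<phi> t l))"
    using A_carrier assms by (simp add: index_poly_mat sum_distrib_right mult.assoc)
  also have "\<dots> = (\<Sum>d\<le>degree p. coeff p d * (\<Sum>l<n. (A ^\<^sub>m d) $$ (i, l) * \<phi> t l))"
    by (subst sum.swap) (simp add: sum_distrib_left)
  also have "\<dots> = poly p (ev t) * \<phi> t i"
    using assms by (simp add: pow_eigen poly_altdef sum_distrib_right mult.assoc)
  finally show ?thesis .
qed

text \<open>Each column of a spectral sum is a combination of the eigenvectors
  \<open>\<phi> t\<close>, on which p(A) acts as the scalar \<open>poly p (ev t)\<close>. Taking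
  \<open>c t\<close> to be 1 yields the entries of p(A); taking it to be
  \<open>poly q (ev t)\<close> yields products.\<close>

lemma poly_mat_mult_spectral:
  assumes "i < n" "j < n"
  shows "(\<Sum>l<n. poly_mat n p A $$ (i, l) * (\<Sum>t\<in>I. c t * (\<phi> t l * \<psi> t j))) =
    (\<Sum>t\<in>I. poly p (ev t) * c t * (\<phi> t i * \<psi> t j))"
proof -
  have "(\<Sum>l<n. poly_mat n p A $$ (i, l) * (\<Sum>t\<in>I. c t * (\<phi> t l * \<psi> t j))) =
      (\<Sum>t\<in>I. (\<Sum>l<n. poly_mat n p A $$ (i, l) * \<phi> t l) * (c t * \<psi> t j))"
    unfolding sum_distrib_left sum_distrib_right
    by (subst sum.swap) (simp add: mult_ac)
  also have "\<dots> = (\<Sum>t\<in>I. poly p (ev t) * c t * (\<phi> t i * \<psi> t j))"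
    using assms by (intro sum.cong refl) (subst poly_eigen, simp_all add: mult_ac)
  finally show ?thesis .
qed

text \<open>Multiply p(A) by the identity matrix and expand the latter by \<open>resolution\<close>.
  Thus p(A) depends on p only through its values at the eigenvalues.\<close>

lemma index_poly_mat_spectral:
  assumes "i < n" "j < n"
  shows "poly_mat n p A $$ (i, j) = (\<Sum>t\<in>I. poly p (ev t) * (\<phi> t i * \<psi> t j))"
proof -
  have "poly_mat n p A $$ (i, j) = (\<Sum>l<n. poly_mat n p A $$ (i, l) * (if l = j then 1 else 0))"
    using assms by (simp add: if_distrib[where f = "\<lambda>x. _ * x"] cong: if_cong)
  also have "\<dots> = (\<Sum>l<n. poly_mat n p A $$ (i, l) * (\<Sum>t\<in>I. 1 * (\<phi> t l * \<psi> t j)))"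
    using assms by (intro sum.cong refl) (simp add: resolution)
  also have "\<dots> = (\<Sum>t\<in>I. poly p (ev t) * (\<phi> t i * \<psi> t j))"
    using assms by (subst poly_mat_mult_spectral) simp_all
  finally show ?thesis .
qed

text \<open>Reduces identities between polynomials in \<open>A\<close> to comparing values at the
  eigenvalues, which avoids convolutions of coefficients when multiplying.\<close>

lemma poly_mat_eqI:
  assumes "M \<in> carrier_mat n n"
    and "\<And>i j. i < n \<Longrightarrow> j < n \<Longrightarrow> M $$ (i, j) = (\<Sum>t\<in>I. poly p (ev t) * (\<phi> t i * \<psi> t j))"
  shows "M = poly_mat n p A"
  using assms poly_mat_carrier[OF A_carrier, of p] index_poly_mat_spectral by (intro eq_matI) auto

lemma poly_mat_mult: "poly_mat n p A * poly_mat n q A = poly_mat n (p * q) A"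
proof (rule poly_mat_eqI)
  fix i j assume ij: "i < n" "j < n"
  have "(poly_mat n p A * poly_mat n q A) $$ (i, j) =
      (\<Sum>l<n. poly_mat n p A $$ (i, l) * poly_mat n q A $$ (l, j))"
    using ij poly_mat_carrier[OF A_carrier] by (intro index_mult_mat_sum)
  also have "\<dots> = (\<Sum>l<n. poly_mat n p A $$ (i, l) *
      (\<Sum>t\<in>I. poly q (ev t) * (\<phi> t l * \<psi> t j)))"
    using ij by (intro sum.cong refl) (simp add: index_poly_mat_spectral)
  finally show "(poly_mat n p A * poly_mat n q A) $$ (i, j) =
      (\<Sum>t\<in>I. poly (p * q) (ev t) * (\<phi> t i * \<psi> t j))"
    using ij by (simp add: poly_mat_mult_spectral)
qed (metis A_carrier mult_carrier_mat poly_mat_carrier)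

lemma poly_mat_add: "poly_mat n p A + poly_mat n q A = poly_mat n (p + q) A"
  using poly_mat_carrier[OF A_carrier, of p] poly_mat_carrier[OF A_carrier, of q]
  by (intro poly_mat_eqI) (auto simp: index_poly_mat_spectral sum.distrib algebra_simps)

lemma poly_mat_smult: "c \<cdot>\<^sub>m poly_mat n p A = poly_mat n ([:c:] * p) A"
  using poly_mat_carrier[OF A_carrier, of p]
  by (intro poly_mat_eqI) (auto simp: index_poly_mat_spectral sum_distrib_left mult.assoc)

lemma poly_mat_0: "0\<^sub>m n n = poly_mat n 0 A"
  by (intro poly_mat_eqI) auto

lemma poly_mat_1: "1\<^sub>m n = poly_mat n 1 A"
  by (intro poly_mat_eqI) (auto simp: resolution)

text \<open>A nonzero coordinate of the eigenvector recovers \<open>poly p (ev t)\<close> from p(A);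
  the converse is the spectral form of the entries.\<close>

lemma poly_mat_eq_iff: "poly_mat n p A = poly_mat n q A \<longleftrightarrow> (\<forall>t\<in>I. poly p (ev t) = poly q (ev t))"
proof
  assume eq: "poly_mat n p A = poly_mat n q A"
  show "\<forall>t\<in>I. poly p (ev t) = poly q (ev t)"
  proof
    fix t assume t: "t \<in> I"
    then obtain i where "i < n" "\<phi> t i \<noteq> 0" using nonzero by blast
    then show "poly p (ev t) = poly q (ev t)"
      using poly_eigen[OF t, of i p] poly_eigen[OF t, of i q] eq by simp
  qed
next
  assume "\<forall>t\<in>I. poly p (ev t) = poly q (ev t)"
  then show "poly_mat n p A = poly_mat n q A"
    using poly_mat_carrier[OF A_carrier] by (intro poly_mat_eqI) (simp_all add: index_poly_mat_spectral)
qed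

text \<open>The record update has the same shape as in \<open>adjacency_algebra\<close>, so the two
  agree on unfolding when \<open>A\<close> is the adjacency matrix.\<close>

definition poly_algebra :: "('a, 'a mat) module" where
  "poly_algebra = (module_mat TYPE('a) n n)\<lparr>carrier := {poly_mat n p A | p. True}\<rparr>"

lemma poly_algebra_simps:
  "carrier poly_algebra = range (\<lambda>p. poly_mat n p A)"
  "monoid.mult poly_algebra = (*)" "one poly_algebra = 1\<^sub>m n"
  "add poly_algebra = (+)" "zero poly_algebra = 0\<^sub>m n n" "smult poly_algebra = (\<cdot>\<^sub>m)"
  by (auto simp: poly_algebra_def module_mat_simps)

text \<open>Used from left to right, these rules move matrix operations into the polynomial
  argument, so that the algebra laws, commutativity included, are inherited from
  polynomials.\<close>

lemmas poly_mat_simps = poly_mat_mult poly_mat_add poly_mat_smult poly_mat_0 poly_mat_1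

lemma algebra_poly_algebra: "algebra class_ring poly_algebra"
proof (rule algebraI)
  show "cring (class_ring :: 'a ring)" by (rule class_cring.cring_axioms)
  show "cring poly_algebra"
  proof (rule cringI)
    show "abelian_group poly_algebra"
    proof (rule abelian_groupI)
      fix M assume "M \<in> carrier poly_algebra"
      then obtain p where "M = poly_mat n p A" by (auto simp: poly_algebra_simps)
      then show "\<exists>N\<in>carrier poly_algebra. N \<oplus>\<^bsub>poly_algebra\<^esub> M = \<zero>\<^bsub>poly_algebra\<^esub>"
        by (intro bexI[of _ "poly_mat n (- p) A"]) (auto simp: poly_algebra_simps poly_mat_simps)
    qed (auto simp: poly_algebra_simps poly_mat_simps algebra_simps)
    show "comm_monoid poly_algebra"
      by (rule comm_monoidI) (auto simp: poly_algebra_simps poly_mat_simps algebra_simps)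
  qed (auto simp: poly_algebra_simps poly_mat_simps algebra_simps)
qed (auto simp: poly_algebra_simps poly_mat_simps smult_add_left smult_add_right mult_ac)

end

section \<open>Evaluation at the distinct eigenvalues as an isomorphism\<close>

text \<open>While \<open>ev\<close> may repeat eigenvalues, \<open>\<mu>\<close> lists each once.
  Sending p(A) to the values of p at all \<open>\<mu> j\<close> is injective by
  \<open>poly_mat_eq_iff\<close> and surjective by interpolation.\<close>

theorem poly_algebra_isomorphic_rat_power:
  fixes A :: "rat mat"
  assumes "spectral_resolution n A I ev \<phi> \<psi>"
    and spectrum: "ev ` I = \<mu> ` {..<m}" and inj: "inj_on \<mu> {..<m}"
  shows "algebra_isomorphic class_ring (spectral_resolution.poly_algebra n A) (rat_power_algebra m)"
proof -
  interpret spectral_resolution n A I ev \<phi> \<psi> by fact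
  have eq_iff: "poly_mat n p A = poly_mat n q A \<longleftrightarrow> (\<forall>j<m. poly p (\<mu> j) = poly q (\<mu> j))" for p q
  proof -
    have "(\<forall>t\<in>I. poly p (ev t) = poly q (ev t)) \<longleftrightarrow> (\<forall>x\<in>ev ` I. poly p x = poly q x)" by blast
    then show ?thesis unfolding poly_mat_eq_iff spectrum by auto
  qed
  \<comment> \<open>Any polynomial representing \<open>M\<close> may be chosen: by
    \<open>eq_iff\<close> all of them agree at every \<open>\<mu> j\<close>.\<close>
  define f where "f M = vec m (\<lambda>j. poly (SOME p. M = poly_mat n p A) (\<mu> j))" for M
  have f: "f (poly_mat n p A) = vec m (\<lambda>j. poly p (\<mu> j))" for p
  proof -
    have "poly_mat n p A = poly_mat n (SOME q. poly_mat n p A = poly_mat n q A) A"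
      by (rule someI) (rule refl)
    then have "\<forall>j<m. poly p (\<mu> j) = poly (SOME q. poly_mat n p A = poly_mat n q A) (\<mu> j)"
      by (rule eq_iff[THEN iffD1])
    then show ?thesis unfolding f_def by (intro eq_vecI) simp_all
  qed
  have "f \<in> ring_iso poly_algebra (rat_power_algebra m)"
    unfolding ring_iso_def
  proof (safe intro!: ring_hom_memI)
    show "bij_betw f (carrier poly_algebra) (carrier (rat_power_algebra m))"
    proof (rule bij_betwI')
      fix M N assume "M \<in> carrier poly_algebra" "N \<in> carrier poly_algebra"
      then show "(f M = f N) = (M = N)"
        by (auto simp: poly_algebra_simps f eq_iff vec_eq_iff)
    next
      fix x assume "x \<in> carrier (rat_power_algebra m)"
      then have x: "x \<in> carrier_vec m" by (simp add: rat_power_algebra_def module_vec_simps)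
      \<comment> \<open>The coordinate to prescribe at an eigenvalue is found by inverting
        \<open>\<mu>\<close>, which is injective.\<close>
      obtain p where p: "\<forall>y\<in>\<mu> ` {..<m}. poly p y = x $ (the_inv_into {..<m} \<mu> y)"
        using poly_interpolation_exists[of "\<mu> ` {..<m}" "\<lambda>y. x $ the_inv_into {..<m} \<mu> y"] by auto
      have "x = f (poly_mat n p A)"
        using x p inj by (intro eq_vecI) (auto simp: f the_inv_into_f_f)
      then show "\<exists>M\<in>carrier poly_algebra. x = f M" by (auto simp: poly_algebra_simps)
    qed (auto simp: poly_algebra_simps f rat_power_algebra_def module_vec_simps)
  qed (auto simp: poly_algebra_simps poly_mat_simps f rat_power_algebra_def module_vec_simps
      intro!: eq_vecI)
  moreover have "f (a \<odot>\<^bsub>poly_algebra\<^esub> M) = a \<odot>\<^bsub>rat_power_algebra m\<^esub> f M"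
    if "M \<in> carrier poly_algebra" for a M
    using that
    by (auto simp: poly_algebra_simps poly_mat_smult f rat_power_algebra_def module_vec_simps
      intro!: eq_vecI)
  ultimately show ?thesis
    unfolding algebra_isomorphic_def using algebra_poly_algebra algebra_rat_power by blast
qed

section \<open>Characters of the cube: eigenvalues and orthogonality\<close>

definition character :: "nat set \<Rightarrow> (nat \<Rightarrow> int) \<Rightarrow> rat" where
  "character T g = (\<Prod>i\<in>T. if g i = 0 then 1 else - 1)"

lemma character_nonzero: "character T g \<noteq> 0"
  by (cases "finite T") (auto simp: character_def)

lemma pverts_hamming_cube: "pverts (hamming_cube k) = ({1..k} \<rightarrow>\<^sub>E {0, 1})"
proof -
  have "{0..<2::int} = {0, 1}" by auto
  then show ?thesis
    by (simp add: hamming_cube_def cayley_graph_def Z2_power_def integer_mod_group_def)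
qed

lemma hamming_cube_binary:
  "g \<in> pverts (hamming_cube k) \<Longrightarrow> i \<in> {1..k} \<Longrightarrow> g i = 0 \<or> g i = 1"
  by (auto simp: pverts_hamming_cube)

lemma flip_in_hamming_cube:
  assumes "g \<in> pverts (hamming_cube k)" "i \<in> {1..k}"
  shows "g(i := 1 - g i) \<in> pverts (hamming_cube k)"
  using assms hamming_cube_binary[OF assms] by (auto simp: pverts_hamming_cube PiE_iff extensional_def)

text \<open>On the residues 0 and 1, adding 1 modulo 2 is the map sending x to 1 - x. A difference
  equal to the i-th basis vector therefore means that exactly coordinate i is flipped.\<close>

lemma parcs_hamming_cube:
  assumes g: "g \<in> pverts (hamming_cube k)"
  shows "(g, h) \<in> parcs (hamming_cube k) \<longleftrightarrow> h \<in> (\<lambda>i. g(i := 1 - g i)) ` {1..k}"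
proof -
  have diff: "h \<otimes>\<^bsub>Z2_power k\<^esub> inv\<^bsub>Z2_power k\<^esub> g = std_basis k i \<longleftrightarrow> h = g(i := 1 - g i)"
    if h: "h \<in> pverts (hamming_cube k)" and i: "i \<in> {1..k}" for h i
  proof -
    have carr: "g \<in> (\<Pi>\<^sub>E i\<in>{1..k}. carrier (integer_mod_group 2))"
      using g by (auto simp: hamming_cube_def cayley_graph_def Z2_power_def)
    have inv: "inv\<^bsub>Z2_power k\<^esub> g = (\<lambda>j\<in>{1..k}. (- g j) mod 2)"
      unfolding Z2_power_def using carr
      by (subst inv_product_group) (auto intro!: restrict_ext inv_integer_mod_group[of _ 2, simplified])
    have mult: "h \<otimes>\<^bsub>Z2_power k\<^esub> inv\<^bsub>Z2_power k\<^esub> g = (\<lambda>j\<in>{1..k}. (h j - g j) mod 2)"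
      unfolding inv by (auto simp: Z2_power_def mod_simps intro!: restrict_ext)
    have "h \<otimes>\<^bsub>Z2_power k\<^esub> inv\<^bsub>Z2_power k\<^esub> g = std_basis k i \<longleftrightarrow>
        (\<forall>j\<in>{1..k}. (h j - g j) mod 2 = (if j = i then 1 else 0))"
      unfolding mult std_basis_def by (auto simp: fun_eq_iff)
    also have "\<dots> \<longleftrightarrow> (\<forall>j\<in>{1..k}. h j = (if j = i then 1 - g j else g j))"
    proof (intro ball_cong refl)
      fix j assume "j \<in> {1..k}"
      then show "((h j - g j) mod 2 = (if j = i then 1 else 0)) \<longleftrightarrow>
          h j = (if j = i then 1 - g j else g j)"
        using hamming_cube_binary[OF g, of j] hamming_cube_binary[OF h, of j] by auto
    qed
    \<comment> \<open>Vertices are extensional functions, so agreement on \<open>{1..k}\<close>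
      already gives equality.\<close>
    also have "\<dots> \<longleftrightarrow> h = g(i := 1 - g i)"
      using g h i by (auto simp: pverts_hamming_cube PiE_iff extensional_def fun_eq_iff)
    finally show ?thesis .
  qed
  have "(g, h) \<in> parcs (hamming_cube k) \<longleftrightarrow> h \<in> pverts (hamming_cube k) \<and>
      (\<exists>i\<in>{1..k}. h \<otimes>\<^bsub>Z2_power k\<^esub> inv\<^bsub>Z2_power k\<^esub> g = std_basis k i)"
    using g by (auto simp: hamming_cube_def cayley_graph_def)
  then show ?thesis
    using diff flip_in_hamming_cube[OF g] by blast
qed

lemma character_flip:
  assumes "finite T" "g i = 0 \<or> g i = 1"
  shows "character T (g(i := 1 - g i)) = (if i \<in> T then - 1 else 1) * character T g"
proof (cases "i \<in> T")
  case True
  have "(\<Prod>j\<in>T - {i}. if (g(i := 1 - g i)) j = 0 then 1 else - 1) =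
      (\<Prod>j\<in>T - {i}. if g j = 0 then 1 else - 1 :: rat)"
    by (rule prod.cong) auto
  then show ?thesis
    using True assms by (auto simp: character_def prod.remove[of T i])
next
  case False
  have "character T (g(i := 1 - g i)) = character T g"
    unfolding character_def using False by (intro prod.cong) auto
  then show ?thesis using False by simp
qed

text \<open>Of the k neighbours of \<open>g\<close>, those flipped at a coordinate in
  \<open>T\<close> negate the character and the others preserve it, which gives (k - |T|) -
  |T|.\<close>

lemma character_eigen:
  assumes g: "g \<in> pverts (hamming_cube k)" and T: "T \<subseteq> {1..k}"
  shows "(\<Sum>h\<in>pverts (hamming_cube k). (if (g, h) \<in> parcs (hamming_cube k) then 1 else 0) * character T h) =
    (of_nat k - 2 * of_nat (card T)) * character T g"
proof -
  let ?flip = "\<lambda>i. g(i := 1 - g i)"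
  have fin: "finite (pverts (hamming_cube k))" by (simp add: pverts_hamming_cube finite_PiE)
  have finT: "finite T" using T finite_subset by blast
  have sub: "?flip ` {1..k} \<subseteq> pverts (hamming_cube k)"
    using flip_in_hamming_cube[OF g] by blast
  have inj: "inj_on ?flip {1..k}"
  proof (rule inj_onI)
    fix i j assume eq: "?flip i = ?flip j"
    \<comment> \<open>By parity a flip really changes its coordinate, so flips at different
      coordinates differ.\<close>
    have "1 - g i \<noteq> g i" by presburger
    then show "i = j"
      using fun_cong[OF eq, of i] by (cases "i = j") simp_all
  qed
  have "(\<Sum>h\<in>pverts (hamming_cube k). (if (g, h) \<in> parcs (hamming_cube k) then 1 else 0) * character T h) =
      (\<Sum>h\<in>pverts (hamming_cube k). if h \<in> ?flip ` {1..k} then character T h else 0)"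
    by (intro sum.cong refl) (simp add: parcs_hamming_cube[OF g])
  also have "\<dots> = (\<Sum>h\<in>?flip ` {1..k}. character T h)"
    using sub fin by (simp add: sum.inter_restrict[symmetric] Int_absorb1)
  also have "\<dots> = (\<Sum>i\<in>{1..k}. (if i \<in> T then - 1 else 1) * character T g)"
    unfolding sum.reindex[OF inj] o_def
    by (intro sum.cong refl character_flip[OF finT] hamming_cube_binary[OF g])
  also have "\<dots> = (\<Sum>i\<in>{1..k}. 1 - (if i \<in> T then 2 else 0)) * character T g"
    unfolding sum_distrib_right by (intro sum.cong) auto
  also have "(\<Sum>i\<in>{1..k}. 1 - (if i \<in> T then 2 else 0) :: rat) = of_nat k - 2 * of_nat (card T)"
    using T by (simp add: sum_subtractf sum.inter_restrict[symmetric] Int_absorb1)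
  finally show ?thesis .
qed

text \<open>The sum over all subsets \<open>T\<close> is the expansion of a product with one factor
  per coordinate. A factor is 1 + 1 where \<open>g\<close> and \<open>h\<close> agree and -1 + 1
  where they differ.\<close>

lemma character_orthogonal:
  assumes g: "g \<in> pverts (hamming_cube k)" and h: "h \<in> pverts (hamming_cube k)"
  shows "(\<Sum>T\<in>Pow {1..k}. character T g * character T h) = (if g = h then 2 ^ k else 0)"
proof -
  let ?s = "\<lambda>x :: int. if x = 0 then 1 else - 1 :: rat"
  have "(\<Sum>T\<in>Pow {1..k}. character T g * character T h) = (\<Prod>i\<in>{1..k}. ?s (g i) * ?s (h i) + 1)"
    by (simp add: prod_add character_def prod.distrib)
  also have "\<dots> = (if g = h then 2 ^ k else 0)"
  proof (cases "g = h")
    case True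
    have "(\<Prod>i\<in>{1..k}. ?s (g i) * ?s (h i) + 1) = (\<Prod>i\<in>{1..k}. 2)"
      using True by (intro prod.cong) auto
    then show ?thesis using True by simp
  next
    case False
    then obtain i where "i \<in> {1..k}" "g i \<noteq> h i"
      using g h PiE_ext unfolding pverts_hamming_cube by blast
    then show ?thesis
      using False hamming_cube_binary[OF g, of i] hamming_cube_binary[OF h, of i]
      by (auto intro!: prod_zero bexI[of _ i])
  qed
  finally show ?thesis .
qed

section \<open>The spectrum of the cube and its adjacency algebra\<close>

text \<open>The dual family is the characters divided by \<open>2 ^ k\<close>, the diagonal value in
  \<open>character_orthogonal\<close>.\<close>

lemma hamming_cube_spectral_resolution:
  assumes v: "vertex_enumeration (hamming_cube k) v"
  shows "spectral_resolution (card (pverts (hamming_cube k))) (adjacency_matrix (hamming_cube k) v)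
    (Pow {1..k}) (\<lambda>T. of_nat k - 2 * of_nat (card T))
    (\<lambda>T i. character T (v i)) (\<lambda>T i. character T (v i) / 2 ^ k)"
proof
  let ?n = "card (pverts (hamming_cube k))" and ?A = "adjacency_matrix (hamming_cube k) v"
  have bij: "bij_betw v {..<?n} (pverts (hamming_cube k))"
    using v by (simp add: vertex_enumeration_def)
  then have vert: "i < ?n \<Longrightarrow> v i \<in> pverts (hamming_cube k)" for i
    by (auto dest: bij_betwE)
  show "?A \<in> carrier_mat ?n ?n" by (simp add: adjacency_matrix_def)
  show "\<exists>i<?n. character T (v i) \<noteq> 0" for T
    \<comment> \<open>Index 0 is admissible because there are \<open>2 ^ k\<close> vertices, hence
      at least one.\<close>
    by (auto simp: character_nonzero card_hamming_cube intro: exI[of _ 0])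
  fix i assume i: "i < ?n"
  show "(\<Sum>T\<in>Pow {1..k}. character T (v i) * (character T (v j) / 2 ^ k)) = (if i = j then 1 else 0)"
    if j: "j < ?n" for j
  proof -
    have "v i = v j \<longleftrightarrow> i = j"
      using bij i j by (auto simp: bij_betw_def inj_on_def)
    then show ?thesis
      using character_orthogonal[OF vert[OF i] vert[OF j]] by (simp add: sum_divide_distrib[symmetric])
  qed
  fix T assume "T \<in> Pow {1..k}"
  then have T: "T \<subseteq> {1..k}" by simp
  have "(\<Sum>l<?n. ?A $$ (i, l) * character T (v l)) =
      (\<Sum>l<?n. (if (v i, v l) \<in> parcs (hamming_cube k) then 1 else 0) * character T (v l))"
    using i by (intro sum.cong) (auto simp: adjacency_matrix_def)
  also have "\<dots> = (\<Sum>h\<in>pverts (hamming_cube k).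
      (if (v i, h) \<in> parcs (hamming_cube k) then 1 else 0) * character T h)"
    by (rule sum.reindex_bij_betw[OF bij])
  also have "\<dots> = (of_nat k - 2 * of_nat (card T)) * character T (v i)"
    by (rule character_eigen[OF vert[OF i] T])
  finally show "(\<Sum>l<?n. ?A $$ (i, l) * character T (v l)) =
    (of_nat k - 2 * of_nat (card T)) * character T (v i)" .
qed simp

theorem theorem13p1:
  fixes k :: nat and v :: "nat \<Rightarrow> (nat \<Rightarrow> int)"
  assumes "k \<ge> 1"
    and "vertex_enumeration (hamming_cube k) v"
  shows "algebra_isomorphic (class_ring :: rat ring)
           (adjacency_algebra (hamming_cube k) v) (rat_power_algebra (k + 1))"
proof -
  let ?n = "card (pverts (hamming_cube k))" and ?A = "adjacency_matrix (hamming_cube k) v"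
  define \<mu> :: "nat \<Rightarrow> rat" where "\<mu> j = of_nat k - 2 * of_nat j" for j
  note res = hamming_cube_spectral_resolution[OF assms(2)]
  \<comment> \<open>The eigenvalue of \<open>T\<close> depends only on its size, which takes the k +
    1 values from 0 to k; \<open>{1..j}\<close> realises the size j.\<close>
  have "card ` Pow {1..k} = {..<k + 1}"
  proof (intro equalityI subsetI)
    fix j assume "j \<in> {..<k + 1}"
    then show "j \<in> card ` Pow {1..k}"
      by (intro image_eqI[of _ _ "{1..j}"]) auto
  qed (auto simp: less_Suc_eq_le dest: card_mono[rotated])
  then have "(\<lambda>T. of_nat k - 2 * of_nat (card T)) ` Pow {1..k} = \<mu> ` {..<k + 1}"
    unfolding \<mu>_def by (metis image_image)
  moreover have "inj_on \<mu> {..<k + 1}" by (auto simp: \<mu>_def inj_on_def)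
  moreover have "adjacency_algebra (hamming_cube k) v = spectral_resolution.poly_algebra ?n ?A"
    by (simp add: adjacency_algebra_def spectral_resolution.poly_algebra_def[OF res] Let_def)
  ultimately show ?thesis
    using poly_algebra_isomorphic_rat_power[OF res] by simp
qed

end
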